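(* Let $\alpha>1$ be a real algebraic number with minimal polynomial $P(x)\in\mathbb{Z}[x]$. Let $\beta\in\mathbb{R}$ and let $\ell$ be a positive integer. There exists a strictly increasing sequence of positive integers $(n_k)_{k\geqslant 1}$ such that the sequence $(n_{k+1}-\alpha n_k-\beta\ln n_k)_{k\geqslant 1}$ converges to a cycle of period $\ell$ if and only if $\alpha$ is a Pisot number and $\theta:=\frac{\beta\ln\alpha}{\alpha-1}$ belongs to $\frac{1}{\ell P(1)}\mathbb{Z}$.
   Context: The minimal polynomial of $\alpha$ means the irreducible polynomial $P(x)\in\mathbb{Z}[x]$ (irreducible in $\mathbb{Z}[x]$) with $P(\alpha)=0$ and positive leading coefficient; if $\alpha$ is an algebraic integer, $P$ is monic. (Since $\alpha\neq 1$, $P(1)\neq 0$.) A Pisot number is a real algebraic integer $\alpha>1$ all of whose Galois conjugates other than $\alpha$ have modulus strictly less than $1$. A real sequence $(x_k)_{k\geqslant 1}$ converges to a cycle of period $\ell$ if the subsequence $(x_{k\ell+j})_{k\geqslant 1}$ converges (to a real limit) for each integer $0\leqslant j<\ell$. The integer $\ell$ is not required to be the exact period. *)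

theory Defs
  imports "HOL-Analysis.Analysis" "HOL-Computational_Algebra.Computational_Algebra"
begin

text \<open>
  Irreducibility is taken in the ring \<open>\<int>[x]\<close>, where non-unit constants are not invertible, so that
  \<^term>\<open>P\<close> is automatically primitive; it need not be monic.
\<close>
definition minimal_int_poly :: "int poly \<Rightarrow> 'a::field_char_0 \<Rightarrow> bool" where
  "minimal_int_poly P a \<longleftrightarrow>
     irreducible P \<and> poly (map_poly of_int P) a = 0 \<and> lead_coeff P > 0"

definition galois_conjugate :: "real \<Rightarrow> complex \<Rightarrow> bool" where
  "galois_conjugate a z \<longleftrightarrow>
     (\<exists>P. minimal_int_poly P a \<and> poly (map_poly of_int P) z = 0)"

definition pisot :: "real \<Rightarrow> bool" where
  "pisot a \<longleftrightarrow> algebraic_int a \<and> a > 1 \<and>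
     (\<forall>z. galois_conjugate a z \<and> z \<noteq> complex_of_real a \<longrightarrow> norm z < 1)"

text \<open>
  Sequences are indexed from 1. Index 0 is reached below only for \<open>k = j = 0\<close>, and the value there
  does not affect convergence.
\<close>
definition converges_to_cycle :: "(nat \<Rightarrow> real) \<Rightarrow> nat \<Rightarrow> bool" where
  "converges_to_cycle x l \<longleftrightarrow> (\<forall>j<l. convergent (\<lambda>k. x (k * l + j)))"

end

theory Submission
  imports Defs "HOL-Complex_Analysis.Cauchy_Integral_Formula"
begin

text \<open>
  Write \<open>P\<^sup>*\<close> for the reversed polynomial of \<open>P = (x - \<alpha>) Q\<close>, so that multiplying a generating function by
  \<open>P\<^sup>*\<close> applies the shift operator \<open>P(E)\<close> to the coefficients.

  If the sequence converges to a cycle, then \<open>ln n\<^sub>k - k ln \<alpha>\<close> converges, so \<open>D\<^sub>k = n\<^bsub>k+l\<^esub> - n\<^sub>k\<close> satisfies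
  \<open>D\<^bsub>k+1\<^esub> - \<alpha> D\<^sub>k \<longlonglongrightarrow> l \<beta> ln \<alpha>\<close>. Applying \<open>Q(E)\<close> gives a convergent, hence eventually constant, sequence of
  integers with limit \<open>Q(1) l \<beta> ln \<alpha> = - l \<theta> P(1)\<close>. Therefore \<open>W = (1 - x) D(x)\<close> is an integer power series
  with \<open>P\<^sup>* W\<close> a polynomial. As \<open>P\<^sup>*\<close> is irreducible, a Bezout relation yields an integer power
  series \<open>U\<close> and an integer \<open>m \<noteq> 0\<close> with \<open>P\<^sup>* U = m\<close>; by Gauss's lemma for power series (as in Fatou's
  lemma) \<open>P\<close> is monic, and since the coefficients of \<open>(1 - \<alpha> x) U\<close> tend to \<open>0\<close>, so does
  \<open>m \<gamma>\<^sup>k\<close> for every other conjugate \<open>\<gamma>\<close>.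

  Conversely, if \<open>\<alpha>\<close> is Pisot and \<open>\<theta> = m / (l P(1))\<close>, take integers with generating function
  \<open>(U + N) / P\<^sup>*\<close> where \<open>u\<^sub>k = \<lfloor>-m k / l\<rfloor>\<close> is linear plus periodic. Since \<open>1 / Q\<^sup>*\<close> has
  radius of convergence greater than 1, \<open>n\<^bsub>k+1\<^esub> - \<alpha> n\<^sub>k - k \<beta> ln \<alpha>\<close> converges to a cycle, and the constant \<open>N\<close> is
  chosen so that \<open>n\<^sub>k / \<alpha>\<^sup>k\<close> has a positive limit.
\<close>

section \<open>Minimal polynomials over the integers\<close>

abbreviation ipoly :: "int poly \<Rightarrow> 'a::comm_ring_1 poly" where
  "ipoly \<equiv> map_poly of_int"

lemma ipoly_add: "ipoly (p + q) = ipoly p + (ipoly q :: 'a::comm_ring_1 poly)"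
  by (intro poly_eqI) (simp add: coeff_map_poly)

lemma ipoly_mult: "ipoly (p * q) = ipoly p * (ipoly q :: 'a::comm_ring_1 poly)"
  by (intro poly_eqI) (simp add: coeff_map_poly coeff_mult)

text \<open>The ring \<open>int poly\<close> is not a principal ideal domain, so the relation only
  reaches a nonzero constant. By pseudo-division, an element \<open>g\<close> of least degree in the
  ideal of \<open>P\<close> and \<open>S\<close> divides a nonzero integer multiple of every
  element; primality of \<open>P\<close> then forces \<open>g\<close> to be constant.\<close>

lemma irreducible_int_poly_bezout:
  fixes P S :: "int poly"
  assumes P: "irreducible P" "degree P > 0" and S: "\<not> P dvd S"
  obtains A B m where "A * P + B * S = [:m:]" "m \<noteq> 0"
proof -
  define I where "I = {A * P + B * S | A B. True}"
  have I_lin: "U * x + V * y \<in> I" if "x \<in> I" "y \<in> I" for U V x y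
  proof -
    from that obtain A B A' B' where "x = A * P + B * S" "y = A' * P + B' * S"
      by (auto simp: I_def)
    then have "U * x + V * y = (U * A + V * A') * P + (U * B + V * B') * S"
      by (simp add: algebra_simps)
    then show ?thesis by (auto simp: I_def)
  qed
  have "P = 1 * P + 0 * S" "S = 0 * P + 1 * S" by simp_all
  then have PI: "P \<in> I" and SI: "S \<in> I" unfolding I_def by blast+
  have "P \<noteq> 0" using P by auto
  obtain g where g: "g \<in> I" "g \<noteq> 0" and gmin: "\<And>h. h \<in> I \<Longrightarrow> h \<noteq> 0 \<Longrightarrow> degree g \<le> degree h"
    using arg_min_nat_lemma[of "\<lambda>h. h \<in> I \<and> h \<noteq> 0" P degree] PI \<open>P \<noteq> 0\<close> by blast
  have div: "\<exists>c q. c \<noteq> 0 \<and> smult c h = g * q" if "h \<in> I" for h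
  proof -
    obtain c q where cq: "c \<noteq> 0" "smult c h = g * q + pseudo_mod h g"
      using pseudo_mod(1)[OF g(2)] by blast
    have "pseudo_mod h g = [:c:] * h + (- q) * g" using cq(2) by simp
    then have "pseudo_mod h g \<in> I" using I_lin[OF that g(1)] by metis
    then have "pseudo_mod h g = 0"
      using gmin pseudo_mod(2)[OF g(2), of h] by fastforce
    then show ?thesis using cq by auto
  qed
  have prime: "prime_elem P" using P(1) by (rule irreducible_imp_prime_elem)
  have const: "degree t = 0" if "P * t = [:c:]" "c \<noteq> 0" for t c
  proof -
    have "t \<noteq> 0" using that by auto
    then have "degree (P * t) = degree P + degree t" using \<open>P \<noteq> 0\<close> by (simp add: degree_mult_eq)
    then show ?thesis using that by simp
  qed
  have ndvd: "\<not> P dvd [:c:]" if "c \<noteq> 0" for c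
  proof
    assume "P dvd [:c:]"
    then have "degree P \<le> degree [:c:]" using that by (intro dvd_imp_degree_le) auto
    then show False using P(2) by simp
  qed
  obtain c q where cq: "c \<noteq> 0" "smult c P = g * q" using div[OF PI] by blast
  have "P dvd g * q" using cq(2) by (metis dvd_refl dvd_smult)
  then have "P dvd g \<or> P dvd q" using prime by (simp add: prime_elem_dvd_mult_iff)
  \<comment> \<open>If \<open>P\<close> divides \<open>g\<close>, it divides a nonzero multiple of
    \<open>S\<close>, which is excluded; if \<open>P\<close> divides \<open>q\<close>, cancelling
    \<open>P\<close> leaves \<open>g\<close> as a divisor of a nonzero constant.\<close>
  then have "degree g = 0"
  proof
    assume "P dvd g"
    obtain c' q' where cq': "c' \<noteq> 0" "smult c' S = g * q'" using div[OF SI] by blast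
    have "P dvd [:c':] * S" using \<open>P dvd g\<close> cq'(2) by simp
    then have "P dvd [:c':] \<or> P dvd S" using prime prime_elem_dvd_mult_iff by blast
    then show ?thesis using ndvd[OF cq'(1)] S by blast
  next
    assume "P dvd q"
    then obtain t where t: "q = P * t" by blast
    have "P * [:c:] = P * (g * t)" using cq(2) t by (simp add: mult.left_commute)
    then have "[:c:] = g * t" using \<open>P \<noteq> 0\<close> by (metis mult_cancel_left)
    then have "degree (g * t) = 0" "t \<noteq> 0" using cq(1) by (metis degree_pCons_0, auto)
    then show ?thesis using g(2) by (simp add: degree_mult_eq)
  qed
  then obtain m where "g = [:m:]" by (rule degree_eq_zeroE)
  moreover obtain A B where "g = A * P + B * S" using g(1) by (auto simp: I_def)
  ultimately show ?thesis using g(2) that[of A B m] by auto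
qed

lemma minimal_int_poly_degree:
  fixes a :: "'a::field_char_0"
  assumes P: "minimal_int_poly P a"
  shows "degree P > 0"
proof (rule ccontr)
  assume "\<not> degree P > 0"
  then obtain c where "P = [:c:]" by (auto elim: degree_eq_zeroE)
  then show False using P by (auto simp: map_poly_pCons minimal_int_poly_def)
qed

text \<open>Otherwise the Bezout relation, evaluated at \<open>a\<close>, would make a nonzero
  integer vanish.\<close>

lemma minimal_int_poly_dvd:
  fixes a :: "'a::field_char_0"
  assumes P: "minimal_int_poly P a" and S: "poly (ipoly S) a = 0" 
  shows "P dvd S"
proof (rule ccontr)
  have irr: "irreducible P" and Pa: "poly (ipoly P) a = 0" and "lead_coeff P > 0"
    using P by (auto simp: minimal_int_poly_def)
  have deg: "degree P > 0" using P by (rule minimal_int_poly_degree)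
  assume "\<not> P dvd S"
  then obtain A B m where "A * P + B * S = [:m:]" "m \<noteq> 0"
    using irreducible_int_poly_bezout[OF irr deg] by blast
  then have "poly (ipoly (A * P + B * S)) a = of_int m" by (simp add: map_poly_pCons)
  then show False using Pa S \<open>m \<noteq> 0\<close> by (simp add: ipoly_add ipoly_mult)
qed

text \<open>Mutual divisibility leaves a unit of the integers, and positive leading coefficients
  exclude -1. This identifies the polynomial hidden in \<open>galois_conjugate\<close> with the
  given one.\<close>

lemma minimal_int_poly_unique:
  fixes a :: "'a::field_char_0"
  assumes P: "minimal_int_poly P a" "minimal_int_poly Q a" 
  shows "P = Q"
proof -
  have "P dvd Q" "Q dvd P"
    using assms by (auto intro: minimal_int_poly_dvd simp: minimal_int_poly_def)
  then obtain u v where u: "Q = P * u" and v: "P = Q * v" by (elim dvdE)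
  have "P \<noteq> 0" using P(1) by (auto simp: minimal_int_poly_def)
  moreover have "P * 1 = P * (u * v)" by (metis u v mult.assoc mult_1_right)
  ultimately have "u * v = 1" by (metis mult_cancel_left)
  then have "u dvd 1" by (metis dvd_triv_left)
  then obtain c where c: "u = [:c:]" "c dvd 1" unfolding is_unit_poly_iff by blast
  have "lead_coeff Q = lead_coeff P * c" using u c by (simp add: lead_coeff_mult)
  then have "c > 0" using assms by (metis minimal_int_poly_def zero_less_mult_pos)
  then have "c = 1" using c by simp
  then show ?thesis using u c by simp
qed

text \<open>After splitting off the root \<open>c\<close>, the cofactor would still vanish at
  \<open>a\<close>, so \<open>P\<close> would divide a polynomial of smaller degree. The cases 0 and
  1 give \<open>coeff P 0 \<noteq> 0\<close> and \<open>poly P 1 \<noteq> 0\<close> when \<alpha> >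
  1.\<close>

lemma minimal_int_poly_int_root:
  fixes a :: "'a::field_char_0"
  assumes P: "minimal_int_poly P a" and c: "poly P c = 0"
  shows "a = of_int c"
proof (rule ccontr)
  assume "a \<noteq> of_int c"
  obtain R where R: "P = [:-c, 1:] * R"
    using c by (metis dvd_def poly_eq_0_iff_dvd)
  then have "poly (ipoly P) a = (a - of_int c) * poly (ipoly R) a"
    unfolding R ipoly_mult by (simp add: map_poly_pCons algebra_simps)
  then have "poly (ipoly R) a = 0"
    using P \<open>a \<noteq> of_int c\<close> by (simp add: minimal_int_poly_def)
  then have "P dvd R" by (rule minimal_int_poly_dvd[OF P])
  have "R \<noteq> 0" using P R by (auto simp: minimal_int_poly_def)
  then have "degree P = Suc (degree R)" by (subst R) (simp add: degree_mult_eq del: mult_pCons_left)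
  then show False using dvd_imp_degree_le[OF \<open>P dvd R\<close> \<open>R \<noteq> 0\<close>] by simp
qed

text \<open>A double root would make \<open>P\<close> divide its own derivative.\<close>

lemma minimal_int_poly_separable:
  fixes a :: "'a::field_char_0"
  assumes P: "minimal_int_poly P a"
  shows "poly (pderiv (ipoly P)) a \<noteq> 0"
proof
  assume *: "poly (pderiv (ipoly P)) a = 0"
  have "pderiv (ipoly P) = (ipoly (pderiv P) :: 'a poly)"
    by (intro poly_eqI) (simp add: coeff_pderiv coeff_map_poly)
  then have "P dvd pderiv P" using * by (intro minimal_int_poly_dvd[OF P]) simp
  then show False using minimal_int_poly_degree[OF P] not_dvd_pderiv by blast
qed

text \<open>Reversal is multiplicative and, for nonzero constant term, an involution, so
  factorisations of the reversed polynomial reverse to factorisations of \<open>P\<close>.\<close>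

lemma irreducible_reflect_poly:
  fixes P :: "int poly"
  assumes P: "irreducible P" and P0: "coeff P 0 \<noteq> 0"
  shows "irreducible (reflect_poly P)"
proof -
  have unit: "is_unit a" if "is_unit (reflect_poly a)" "coeff a 0 \<noteq> 0" for a :: "int poly"
    using that by (metis is_unit_poly_iff reflect_poly_const reflect_poly_reflect_poly)
  have "P \<noteq> 0" "\<not> is_unit P" using P by (auto simp: irreducible_def)
  show ?thesis
  proof (rule irreducibleI)
    show "reflect_poly P \<noteq> 0" using \<open>P \<noteq> 0\<close> by simp
    show "\<not> is_unit (reflect_poly P)" using unit \<open>\<not> is_unit P\<close> P0 by blast
    fix a b assume ab: "reflect_poly P = a * b"
    have "coeff (a * b) 0 \<noteq> 0" using \<open>P \<noteq> 0\<close> by (metis ab coeff_0_reflect_poly_0_iff)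
    then have nz: "coeff a 0 \<noteq> 0" "coeff b 0 \<noteq> 0" by (auto simp: coeff_mult)
    have "P = reflect_poly a * reflect_poly b"
      using ab P0 by (metis reflect_poly_mult reflect_poly_reflect_poly)
    then have "is_unit (reflect_poly a) \<or> is_unit (reflect_poly b)"
      using P by (auto simp: irreducible_def)
    then show "is_unit a \<or> is_unit b" using unit nz by blast
  qed
qed

lemma reflect_ipoly: "reflect_poly (ipoly P :: 'a::{comm_ring_1,ring_char_0} poly) = ipoly (reflect_poly P)"
  by (intro poly_eqI) (simp add: coeff_reflect_poly coeff_map_poly degree_map_poly)

section \<open>Integer power series\<close>

definition ifps :: "int fps \<Rightarrow> 'a::comm_ring_1 fps" where
  "ifps F = Abs_fps (\<lambda>n. of_int (fps_nth F n))"

lemma ifps_nth [simp]: "fps_nth (ifps F) n = of_int (fps_nth F n)"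
  by (simp add: ifps_def)

lemma ifps_1 [simp]: "ifps 1 = 1"
  by (rule fps_ext) simp

lemma ifps_add: "ifps (F + G) = ifps F + ifps G"
  by (rule fps_ext) simp

lemma ifps_mult: "ifps (F * G) = ifps F * ifps G"
  by (rule fps_ext) (simp add: fps_mult_nth)

lemma ifps_of_poly: "ifps (fps_of_poly p) = fps_of_poly (ipoly p)"
  by (rule fps_ext) (simp add: coeff_map_poly)

text \<open>Gauss's lemma for power series: with \<open>j\<close> the first index where
  \<open>p\<close> does not divide the coefficient of \<open>F\<close>, coefficient
  \<open>j + n\<close> of the product isolates the term
  \<open>fps_nth F j * fps_nth G n\<close>.\<close>

lemma prime_fps_const_dvd_mult:
  fixes F G :: "int fps"
  assumes p: "prime p" and dvd: "\<And>n. p dvd fps_nth (F * G) n" and F: "\<not> p dvd fps_nth F k"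
  shows "p dvd fps_nth G n"
proof (induction n rule: less_induct)
  case (less n)
  define j where "j = (LEAST j. \<not> p dvd fps_nth F j)"
  have j: "\<not> p dvd fps_nth F j" "\<And>i. i < j \<Longrightarrow> p dvd fps_nth F i"
    unfolding j_def using F by (metis (mono_tags) LeastI, metis not_less_Least)
  have "fps_nth (F * G) (j + n) = (\<Sum>i\<in>{0..j+n}. fps_nth F i * fps_nth G (j + n - i))"
    by (rule fps_mult_nth)
  also have "\<dots> = fps_nth F j * fps_nth G n + (\<Sum>i\<in>{0..j+n}-{j}. fps_nth F i * fps_nth G (j + n - i))"
    by (subst sum.remove[of _ j]) auto
  finally have eq: "fps_nth F j * fps_nth G n = fps_nth (F * G) (j + n) - (\<Sum>i\<in>{0..j+n}-{j}. fps_nth F i * fps_nth G (j + n - i))"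
    by simp
  \<comment> \<open>For \<open>i < j\<close> the factor from \<open>F\<close> is divisible by choice
    of \<open>j\<close>; for \<open>i > j\<close> the factor from \<open>G\<close> has index below
    \<open>n\<close>.\<close>
  have "p dvd fps_nth F i * fps_nth G (j + n - i)" if "i \<in> {0..j+n}-{j}" for i
  proof (cases "i < j")
    case False
    then have "j + n - i < n" using that by auto
    then show ?thesis using less.IH by simp
  qed (simp add: j)
  then have "p dvd fps_nth F j * fps_nth G n"
    unfolding eq by (intro dvd_diff dvd dvd_sum)
  then show ?case using j p by (simp add: prime_dvd_mult_iff)
qed

text \<open>Since \<open>F\<close> is primitive, every prime factor of \<open>m\<close> can be
  cancelled from \<open>G\<close>; the descent ends at a unit \<open>m\<close>, which is the product
  of the two constant terms.\<close>

lemma primitive_fps_mult_const: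
  fixes F G :: "int fps"
  assumes prim: "\<And>p. prime p \<Longrightarrow> \<exists>n. \<not> p dvd fps_nth F n"
    and eq: "F * G = fps_const m" and "m \<noteq> 0"
  shows "is_unit (fps_nth F 0)"
  using eq \<open>m \<noteq> 0\<close>
proof (induction "nat \<bar>m\<bar>" arbitrary: m G rule: less_induct)
  case (less m G)
  show ?case
  proof (cases "is_unit m")
    case True
    have "fps_nth F 0 * fps_nth G 0 = m" using less.prems(1) by (metis fps_nth_fps_const fps_mult_nth_0)
    then show ?thesis using True by (metis dvd_mult_left)
  next
    case False
    obtain p where p: "prime p" "p dvd m" using False less.prems(2) prime_divisor_exists by blast
    then obtain m' where m': "m = p * m'" by blast
    obtain k where "\<not> p dvd fps_nth F k" using prim p by blast
    moreover have "p dvd fps_nth (F * G) n" for n using p by (simp add: less.prems)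
    ultimately have "\<forall>n. p dvd fps_nth G n" using prime_fps_const_dvd_mult[OF p(1)] by blast
    then have G: "G = fps_const p * Abs_fps (\<lambda>n. fps_nth G n div p)" (is "_ = _ * ?G")
      by (intro fps_ext) simp
    have "fps_const p * (F * ?G) = fps_const p * fps_const m'"
      using less.prems(1) m' by (subst (asm) G) (simp add: mult_ac fps_const_mult[symmetric] del: fps_const_mult)
    then have "F * ?G = fps_const m'"
      using p by (subst (asm) mult_left_cancel) auto
    moreover have "m' \<noteq> 0" "nat \<bar>m'\<bar> < nat \<bar>m\<bar>"
      using m' less.prems(2) prime_gt_1_int[OF p(1)] by (auto simp: abs_mult)
    ultimately show ?thesis using less.hyps by blast
  qed
qed

lemma irreducible_int_poly_primitive:
  fixes P :: "int poly"
  assumes "irreducible P" "degree P > 0" "prime p"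
  shows "\<exists>n. \<not> p dvd coeff P n"
proof (rule ccontr)
  assume "\<not> ?thesis"
  then have "[:p:] dvd P" by (simp add: const_poly_dvd_iff)
  then obtain t where t: "P = [:p:] * t" by blast
  then have "is_unit [:p:] \<or> is_unit t" using assms(1) by (auto simp: irreducible_def)
  then show False
  proof
    assume "is_unit t"
    then have "degree t = 0" by (auto simp: is_unit_poly_iff)
    then show False using assms(2) t by (simp split: if_splits)
  qed (use assms(3) in \<open>auto simp: is_unit_const_poly_iff prime_elem_def\<close>)
qed

section \<open>Convergence to a cycle and geometric growth\<close>

lemma tendsto_residue_classes:
  fixes f :: "nat \<Rightarrow> 'a::topological_space"
  assumes "l > 0" and lim: "\<And>j. j < l \<Longrightarrow> (\<lambda>k. f (k * l + j)) \<longlonglongrightarrow> c"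
  shows "f \<longlonglongrightarrow> c"
proof (rule topological_tendstoI)
  fix S assume "open S" "c \<in> S"
  then have "\<forall>\<^sub>F k in sequentially. \<forall>j\<in>{..<l}. f (k * l + j) \<in> S"
    using lim by (intro eventually_ball_finite) (auto simp: tendsto_def)
  then obtain K where K: "\<And>k j. k \<ge> K \<Longrightarrow> j < l \<Longrightarrow> f (k * l + j) \<in> S"
    by (auto simp: eventually_sequentially)
  have "f n \<in> S" if "n \<ge> K * l" for n
  proof -
    have "n div l \<ge> K" using that \<open>l > 0\<close> by (simp add: less_eq_div_iff_mult_less_eq)
    then have "f (n div l * l + n mod l) \<in> S"
      using \<open>l > 0\<close> by (intro K mod_less_divisor)
    then show ?thesis by simp
  qed
  then show "\<forall>\<^sub>F n in sequentially. f n \<in> S" by (auto simp: eventually_sequentially)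
qed

lemma converges_to_cycle_Bseq:
  assumes "l > 0" and "converges_to_cycle x l"
  shows "Bseq x"
proof -
  have "\<exists>M. \<forall>k. norm (x (k * l + j)) \<le> M" if "j < l" for j
    using assms that unfolding converges_to_cycle_def
    by (metis convergent_imp_Bseq BseqE)
  then obtain M where M: "\<And>j k. j < l \<Longrightarrow> norm (x (k * l + j)) \<le> M j" by metis
  show ?thesis
  proof (rule BseqI')
    fix n
    have "norm (x (n div l * l + n mod l)) \<le> M (n mod l)"
      using \<open>l > 0\<close> by (intro M mod_less_divisor)
    also have "\<dots> \<le> \<bar>M (n mod l)\<bar>" by simp
    also have "\<dots> \<le> (\<Sum>j<l. \<bar>M j\<bar>)"
      using \<open>l > 0\<close> by (intro member_le_sum) auto
    finally show "norm (x n) \<le> (\<Sum>j<l. \<bar>M j\<bar>)" by simp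
  qed
qed

lemma converges_to_cycle_diff_tendsto_0:
  assumes "l > 0" and "converges_to_cycle x l"
  shows "(\<lambda>k. x (k + l) - x k) \<longlonglongrightarrow> 0"
proof (rule tendsto_residue_classes[OF \<open>l > 0\<close>])
  fix j assume "j < l"
  then obtain c where c: "(\<lambda>k. x (k * l + j)) \<longlonglongrightarrow> c"
    using assms by (auto simp: converges_to_cycle_def convergent_def)
  have "(\<lambda>k. x (Suc k * l + j) - x (k * l + j)) \<longlonglongrightarrow> c - c"
    by (intro tendsto_diff c LIMSEQ_Suc[OF c])
  then show "(\<lambda>k. x (k * l + j + l) - x (k * l + j)) \<longlonglongrightarrow> 0" by (simp add: ac_simps)
qed

text \<open>Used to replace the logarithm of the sequence by its linear main term.\<close>

lemma converges_to_cycle_add: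
  assumes "converges_to_cycle x l" and "convergent y"
  shows "converges_to_cycle (\<lambda>k. x k + y k) l"
  unfolding converges_to_cycle_def
proof (intro allI impI)
  fix j assume "j < l"
  then have "l > 0" by simp
  then have "strict_mono (\<lambda>k. k * l + j)" by (auto simp: strict_mono_def)
  then have "convergent (\<lambda>k. y (k * l + j))"
    using convergent_subseq_convergent[OF assms(2)] by (simp add: o_def)
  then show "convergent (\<lambda>k. x (k * l + j) + y (k * l + j))"
    using assms(1) \<open>j < l\<close> by (auto simp: converges_to_cycle_def intro: convergent_add)
qed

text \<open>Multiplication by \<open>q\<close> is eventually a fixed combination of shifts whose
  weights sum to \<open>poly q 1\<close>.\<close>

lemma fps_of_poly_mult_tendsto:
  fixes F :: "'a::real_normed_field fps"
  assumes "fps_nth F \<longlonglongrightarrow> L"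
  shows "fps_nth (fps_of_poly q * F) \<longlonglongrightarrow> poly q 1 * L"
proof (induction q)
  case (pCons c q)
  have "fps_of_poly (pCons c q) * F = fps_const c * F + fps_X * (fps_of_poly q * F)"
    by (simp add: fps_of_poly_pCons algebra_simps)
  then have "fps_nth (fps_of_poly (pCons c q) * F) (Suc n) =
      c * fps_nth F (Suc n) + fps_nth (fps_of_poly q * F) n" for n
    by simp
  moreover have "(\<lambda>n. c * fps_nth F (Suc n) + fps_nth (fps_of_poly q * F) n) \<longlonglongrightarrow> c * L + poly q 1 * L"
    by (intro tendsto_intros LIMSEQ_Suc assms pCons)
  ultimately have "(\<lambda>n. fps_nth (fps_of_poly (pCons c q) * F) (Suc n)) \<longlonglongrightarrow> c * L + poly q 1 * L"
    by simp
  then show ?case by (simp add: filterlim_sequentially_Suc algebra_simps)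
qed simp

text \<open>The relative error of each step is at most a constant times
  \<open>1 / sqrt (a n)\<close>. This tends to 0, which gives the ratio; the ratio makes the errors
  decay geometrically, so the increments of \<open>ln (a n) - real n * ln \<alpha>\<close> are
  summable.\<close>

lemma perturbed_geometric_growth:
  fixes a x :: "nat \<Rightarrow> real"
  assumes "\<alpha> > 1" and a: "\<And>n. a n \<ge> 1" "filterlim a at_top sequentially" and x: "Bseq x"
    and rec: "\<And>n. a (Suc n) = \<alpha> * a n + \<beta> * ln (a n) + x n"
  shows "(\<lambda>n. a (Suc n) / a n) \<longlonglongrightarrow> \<alpha>" and "convergent (\<lambda>n. ln (a n) - real n * ln \<alpha>)"
proof -
  obtain M where M: "M > 0" "\<And>n. \<bar>x n\<bar> \<le> M" using x by (auto elim: BseqE)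
  define s where "s n = 1 / sqrt (a n)" for n
  \<comment> \<open>The constant \<open>C\<close> below comes from
    \<open>ln (a n) \<le> 2 * sqrt (a n)\<close> and \<open>1 \<le> sqrt (a n)\<close>.\<close>
  define r where "r n = a (Suc n) / a n - \<alpha>" for n
  define C where "C = 2 * \<bar>\<beta>\<bar> + M"
  have "C > 0" using M by (simp add: C_def)
  have r: "\<bar>r n\<bar> \<le> C * s n" for n
  proof -
    have q: "sqrt (a n) \<ge> 1" using a(1) by simp
    have "a n > 0" using a(1)[of n] by linarith
    have "ln (a n) = 2 * ln (sqrt (a n))" using \<open>a n > 0\<close> by (simp add: ln_sqrt)
    also have "\<dots> \<le> 2 * sqrt (a n)" using q ln_bound[of "sqrt (a n)"] by simp
    finally have "\<bar>\<beta> * ln (a n)\<bar> \<le> 2 * \<bar>\<beta>\<bar> * sqrt (a n)"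
      using a(1)[of n] mult_left_mono[of "ln (a n)" "2 * sqrt (a n)" "\<bar>\<beta>\<bar>"] by (simp add: abs_mult)
    moreover have "\<bar>x n\<bar> \<le> M * sqrt (a n)"
      using M(2)[of n] mult_left_mono[OF q, of M] M(1) by linarith
    ultimately have *: "\<bar>\<beta> * ln (a n) + x n\<bar> \<le> C * sqrt (a n)" by (simp add: C_def algebra_simps)
    have "r n = (\<beta> * ln (a n) + x n) / a n" using \<open>a n > 0\<close> by (simp add: r_def rec field_simps)
    then have "\<bar>r n\<bar> \<le> C * sqrt (a n) / a n" using * \<open>a n > 0\<close> by (simp add: divide_right_mono)
    also have "\<dots> = C * s n" using \<open>a n > 0\<close> by (simp add: s_def field_simps)
    finally show ?thesis .
  qed
  have "filterlim (\<lambda>n. sqrt (a n)) at_top sequentially"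
    by (rule filterlim_compose[OF sqrt_at_top a(2)])
  then have s0: "s \<longlonglongrightarrow> 0"
    unfolding s_def by (intro tendsto_divide_0[OF tendsto_const] filterlim_at_top_imp_at_infinity)
  have r0: "r \<longlonglongrightarrow> 0"
    by (rule Lim_null_comparison[OF _ tendsto_mult_right_zero[OF s0, of C]]) (use r in auto)
  then have "(\<lambda>n. r n + \<alpha>) \<longlonglongrightarrow> 0 + \<alpha>" by (intro tendsto_intros)
  then show ratio: "(\<lambda>n. a (Suc n) / a n) \<longlonglongrightarrow> \<alpha>" by (simp add: r_def)
  have "s (Suc n) / s n = sqrt (inverse (a (Suc n) / a n))" for n
    by (simp add: s_def real_sqrt_divide real_sqrt_inverse)
  moreover have "(\<lambda>n. sqrt (inverse (a (Suc n) / a n))) \<longlonglongrightarrow> sqrt (inverse \<alpha>)"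
    using \<open>\<alpha> > 1\<close> by (intro tendsto_intros ratio) auto
  ultimately have sratio: "(\<lambda>n. s (Suc n) / s n) \<longlonglongrightarrow> sqrt (inverse \<alpha>)" by simp
  have "sqrt (inverse \<alpha>) < 1" using \<open>\<alpha> > 1\<close> by (simp add: inverse_less_1_iff)
  then obtain c where c: "sqrt (inverse \<alpha>) < c" "c < 1" using dense by blast
  have spos: "s n > 0" for n using a(1)[of n] by (simp add: s_def)
  obtain N where N: "\<And>n. n \<ge> N \<Longrightarrow> s (Suc n) / s n < c"
    using order_tendstoD(2)[OF sratio c(1)] by (auto simp: eventually_sequentially)
  have "summable s"
  proof (rule summable_ratio_test[OF c(2)])
    fix n assume "n \<ge> N"
    then show "norm (s (Suc n)) \<le> c * norm (s n)"
      using N[of n] spos[of n] spos[of "Suc n"] by (simp add: field_simps)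
  qed
  then have summ: "summable (\<lambda>n. 2 * (C / \<alpha>) * s n)" by (rule summable_mult)
  have "(\<lambda>n. r n / \<alpha>) \<longlonglongrightarrow> 0" using r0 by (rule tendsto_divide_zero)
  \<comment> \<open>The range in which \<open>ln (1 + x)\<close> differs from \<open>x\<close> by at
    most \<open>2 * x^2\<close>, hence is at most \<open>2 * \<bar>x\<bar>\<close> in
    modulus.\<close>
  then have ev: "\<forall>\<^sub>F n in sequentially. \<bar>r n / \<alpha>\<bar> \<le> 1 / 2"
    by (auto dest!: tendstoD[of _ _ _ "1/2"] elim!: eventually_mono)
  define d where "d n = (ln (a (Suc n)) - real (Suc n) * ln \<alpha>) - (ln (a n) - real n * ln \<alpha>)" for n
  have "summable d"
  proof (rule summable_comparison_test_ev[OF _ summ])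
    show "\<forall>\<^sub>F n in sequentially. norm (d n) \<le> 2 * (C / \<alpha>) * s n"
      using ev
    proof eventually_elim
      case (elim n)
      have pos: "a n > 0" "a (Suc n) > 0" using a(1)[of n] a(1)[of "Suc n"] by linarith+
      have "1 + r n / \<alpha> = a (Suc n) / (a n * \<alpha>)"
        using \<open>\<alpha> > 1\<close> pos by (simp add: r_def field_simps)
      then have "d n = ln (1 + r n / \<alpha>)"
        using pos \<open>\<alpha> > 1\<close> by (simp add: d_def ln_mult ln_div algebra_simps)
      then have "\<bar>d n\<bar> \<le> 2 * \<bar>r n / \<alpha>\<bar>"
        using abs_ln_one_plus_x_minus_x_bound[OF elim] elim
          mult_left_mono[OF elim, of "\<bar>r n / \<alpha>\<bar>"] by (simp add: power2_eq_square abs_mult)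
      also have "\<dots> \<le> 2 * (C * s n / \<alpha>)"
        using r[of n] \<open>\<alpha> > 1\<close> by (simp add: divide_right_mono)
      finally show ?case by simp
    qed
  qed
  then have "convergent (\<lambda>n. (\<Sum>i<n. d i) + ln (a 0))"
    by (intro convergent_add convergent_const) (simp add: summable_iff_convergent)
  moreover have "(\<Sum>i<n. d i) = (ln (a n) - real n * ln \<alpha>) - ln (a 0)" for n
    unfolding d_def by (subst sum_lessThan_telescope) simp
  ultimately show "convergent (\<lambda>n. ln (a n) - real n * ln \<alpha>)" by simp
qed

section \<open>Evaluation of integer polynomials, and linear factors as power series\<close>

lemma poly_ipoly_of_int: "poly (ipoly P) (of_int c :: 'a::comm_ring_1) = of_int (poly P c)"
  by (induction P) (simp_all add: map_poly_pCons)

lemma poly_ipoly_of_real: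
  "poly (ipoly P) (of_real a :: 'a::{real_algebra_1,comm_ring_1}) = of_real (poly (ipoly P) a)"
  by (induction P) (simp_all add: map_poly_pCons)

text \<open>The reversal of \<open>x - c\<close>; as a multiplier it acts on coefficients as a
  first-order difference operator.\<close>

definition fps_lin :: "'a::comm_ring_1 \<Rightarrow> 'a fps" where
  "fps_lin c = fps_of_poly [:1, -c:]"

lemma fps_lin_nth_0 [simp]: "fps_nth (fps_lin c) 0 = 1"
  by (simp add: fps_lin_def)

lemma fps_lin_mult_nth_Suc [simp]:
  "fps_nth (fps_lin c * F) (Suc n) = fps_nth F (Suc n) - c * fps_nth F n"
proof -
  have "fps_lin c * F = F - fps_const c * (fps_X * F)"
    by (simp add: fps_lin_def fps_of_poly_pCons algebra_simps flip: fps_const_neg)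
  then show ?thesis by simp
qed

lemma reflect_poly_linear_factor:
  fixes p :: "'a::field_char_0 poly"
  assumes "poly p c = 0"
  obtains q where "p = [:-c, 1:] * q"
    and "fps_of_poly (reflect_poly p) = fps_lin c * fps_of_poly (reflect_poly q)"
proof -
  obtain q where q: "p = [:-c, 1:] * q" using assms by (metis dvd_def poly_eq_0_iff_dvd)
  have "reflect_poly [:-c, 1:] = [:1, -c:]"
    by (intro poly_eqI) (auto simp: coeff_reflect_poly coeff_pCons split: nat.splits)
  then have "reflect_poly p = [:1, -c:] * reflect_poly q" unfolding q reflect_poly_mult by simp
  then show ?thesis using that[OF q] by (simp add: fps_of_poly_mult fps_lin_def del: mult_pCons_left)
qed

section \<open>A cycle forces a Pisot number\<close>

lemma fps_add_tendsto:
  fixes F G :: "'a::real_normed_algebra_1 fps"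
  assumes "fps_nth F \<longlonglongrightarrow> a" and "fps_nth G \<longlonglongrightarrow> b"
  shows "fps_nth (F + G) \<longlonglongrightarrow> a + b"
proof -
  have "fps_nth (F + G) = (\<lambda>n. fps_nth F n + fps_nth G n)" by (rule ext) simp
  then show ?thesis using tendsto_add[OF assms] by simp
qed

lemma fps_of_poly_tendsto_0:
  "fps_nth (fps_of_poly p) \<longlonglongrightarrow> (0 :: 'a::{topological_space,comm_ring_1})"
  by (rule tendsto_eventually) (auto intro!: eventually_mono[OF eventually_gt_at_top[of "degree p"]] coeff_eq_0)

text \<open>Here \<open>W\<close> is rational with irreducible denominator and not a polynomial, so
  Bezout turns it into an integer series \<open>U\<close> whose product with the denominator is a
  nonzero constant. Integrality of \<open>U\<close> makes \<open>P\<close> monic, and the decay of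
  \<open>fps_lin \<alpha> * ifps W\<close> controls the conjugates.\<close>

lemma pisotI:
  fixes W :: "int fps"
  assumes P: "minimal_int_poly P \<alpha>" and "\<alpha> > 1"
    and W: "fps_of_poly (reflect_poly P) * W = fps_of_poly N" "\<And>t. W \<noteq> fps_of_poly t"
    and lim: "fps_nth (fps_lin \<alpha> * ifps W) \<longlonglongrightarrow> 0"
  shows "pisot \<alpha>"
proof -
  define R where "R = reflect_poly P"
  have irr: "irreducible P" and root: "poly (ipoly P) \<alpha> = 0" and lead: "lead_coeff P > 0"
    using P by (auto simp: minimal_int_poly_def)
  have P0: "coeff P 0 \<noteq> 0"
    using minimal_int_poly_int_root[OF P, of 0] \<open>\<alpha> > 1\<close> by (auto simp: poly_0_coeff_0)
  have R: "irreducible R" "degree R > 0"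
    using irreducible_reflect_poly[OF irr P0] minimal_int_poly_degree[OF P] P0 by (auto simp: R_def)
  have "\<not> R dvd N"
  proof
    assume "R dvd N"
    then obtain t where "N = R * t" by blast
    then have "fps_of_poly R * W = fps_of_poly R * fps_of_poly t"
      using W(1) by (simp add: R_def fps_of_poly_mult)
    moreover have "fps_of_poly R \<noteq> 0" using R by (metis degree_0 fps_of_poly_0 fps_of_poly_eq_iff less_irrefl)
    ultimately show False using W(2) by (metis mult_cancel_left)
  qed
  then obtain A B m where AB: "A * R + B * N = [:m:]" and "m \<noteq> 0"
    using irreducible_int_poly_bezout[OF R] by blast
  define U where "U = fps_of_poly A + fps_of_poly B * W"
  have "fps_of_poly R * U = fps_of_poly (A * R + B * N)"
    using W(1) by (simp add: U_def R_def fps_of_poly_add fps_of_poly_mult algebra_simps)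
  then have RU: "fps_of_poly R * U = fps_const m" by (simp add: AB fps_of_poly_const)
  \<comment> \<open>The constant term of \<open>R\<close> is the leading coefficient of
    \<open>P\<close>.\<close>
  have "is_unit (fps_nth (fps_of_poly R) 0)"
    using RU \<open>m \<noteq> 0\<close> by (rule primitive_fps_mult_const[rotated]) (use irreducible_int_poly_primitive[OF R] in simp)
  then have "lead_coeff P = 1" using lead by (simp add: R_def)
  then have "algebraic_int \<alpha>" using root by (auto simp: algebraic_int_altdef_ipoly)
  moreover have "norm z < 1" if z: "galois_conjugate \<alpha> z" "z \<noteq> of_real \<alpha>" for z
  proof -
    have z0: "poly (ipoly P) z = 0"
      using z(1) minimal_int_poly_unique[OF P] by (auto simp: galois_conjugate_def)
    have "poly (ipoly P) (complex_of_real \<alpha>) = 0" by (simp add: poly_ipoly_of_real root)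
    then obtain Q where Q: "ipoly P = [:-complex_of_real \<alpha>, 1:] * Q"
      "fps_of_poly (reflect_poly (ipoly P)) = fps_lin (complex_of_real \<alpha>) * fps_of_poly (reflect_poly Q)"
      by (rule reflect_poly_linear_factor)
    have "poly ([:-complex_of_real \<alpha>, 1:] * Q) z = 0" using z0 unfolding Q(1) .
    then have "poly Q z = 0" using z(2) by simp
    then obtain S where S: "fps_of_poly (reflect_poly Q) = fps_lin z * fps_of_poly (reflect_poly S)"
      by (rule reflect_poly_linear_factor)
    \<comment> \<open>All factors of the reversed polynomial except \<open>fps_lin z\<close> are
      absorbed, so that \<open>V\<close> becomes the geometric series with coefficients
      \<open>m * z ^ n\<close>.\<close>
    define V where "V = fps_of_poly (reflect_poly S) * (fps_lin (complex_of_real \<alpha>) * ifps U)"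
    have "ifps (fps_of_poly R * U) = fps_of_poly (reflect_poly (ipoly P)) * (ifps U :: complex fps)"
      by (simp add: ifps_mult ifps_of_poly R_def reflect_ipoly)
    then have "fps_lin z * V = ifps (fps_of_poly R * U)"
      by (simp add: V_def Q(2) S mult_ac)
    then have zV: "fps_lin z * V = fps_const (of_int m)"
      unfolding RU by (auto simp: fps_eq_iff)
    \<comment> \<open>A polynomial plus a polynomial multiple of the decaying series, so the
      coefficients tend to 0.\<close>
    have "fps_lin (complex_of_real \<alpha>) * ifps U =
        fps_of_poly ([:1, -complex_of_real \<alpha>:] * ipoly A) + fps_of_poly (ipoly B) * (fps_lin (complex_of_real \<alpha>) * ifps W)"
      by (simp add: U_def ifps_add ifps_mult ifps_of_poly fps_of_poly_mult fps_lin_def algebra_simps del: mult_pCons_left)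
    moreover have "fps_nth (fps_of_poly ([:1, -complex_of_real \<alpha>:] * ipoly A)) \<longlonglongrightarrow> 0"
      by (rule fps_of_poly_tendsto_0)
    moreover have "fps_nth (fps_lin (complex_of_real \<alpha>) * ifps W) = (\<lambda>n. of_real (fps_nth (fps_lin \<alpha> * ifps W) n))"
    proof
      show "fps_nth (fps_lin (complex_of_real \<alpha>) * ifps W) n = of_real (fps_nth (fps_lin \<alpha> * ifps W) n)" for n
        by (cases n) auto
    qed
    then have "fps_nth (fps_lin (complex_of_real \<alpha>) * ifps W) \<longlonglongrightarrow> 0"
      using tendsto_of_real[OF lim, where 'a=complex] by simp
    then have "fps_nth (fps_of_poly (ipoly B) * (fps_lin (complex_of_real \<alpha>) * ifps W)) \<longlonglongrightarrow> poly (ipoly B) 1 * 0"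
      by (rule fps_of_poly_mult_tendsto)
    ultimately have "fps_nth (fps_lin (complex_of_real \<alpha>) * ifps U) \<longlonglongrightarrow> 0"
      using fps_add_tendsto by fastforce
    then have V0: "fps_nth V \<longlonglongrightarrow> 0"
      unfolding V_def by (auto dest: fps_of_poly_mult_tendsto)
    have V: "fps_nth V n = of_int m * z ^ n" for n
    proof (induction n)
      case 0
      show ?case using arg_cong[OF zV, of "\<lambda>F. fps_nth F 0"] by simp
    next
      case (Suc n)
      have "fps_nth V (Suc n) - z * fps_nth V n = 0"
        using arg_cong[OF zV, of "\<lambda>F. fps_nth F (Suc n)"] by simp
      then show ?case using Suc by simp
    qed
    show "norm z < 1"
    proof (rule ccontr)
      assume "\<not> norm z < 1"
      then have "norm (fps_nth V n) \<ge> 1" for n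
        using \<open>m \<noteq> 0\<close> mult_mono[of 1 "norm (of_int m :: complex)" 1 "norm z ^ n"]
        by (simp add: V norm_mult norm_power one_le_power)
      moreover obtain n where "norm (fps_nth V n) < 1"
        using tendstoD[OF V0, of 1] by (auto simp: eventually_sequentially)
      ultimately show False by (metis not_less)
    qed
  qed
  ultimately show ?thesis using \<open>\<alpha> > 1\<close> by (auto simp: pisot_def)
qed

lemma int_sequence_tendsto_eventually:
  fixes e :: "nat \<Rightarrow> int"
  assumes "(\<lambda>n. real_of_int (e n)) \<longlonglongrightarrow> c"
  obtains c' where "c = of_int c'" "\<forall>\<^sub>F n in sequentially. e n = c'"
proof -
  obtain K where K: "\<And>n. n \<ge> K \<Longrightarrow> dist (real_of_int (e n)) c < 1/2"
    using tendstoD[OF assms, of "1/2"] by (auto simp: eventually_sequentially)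
  have "e n = e K" if "n \<ge> K" for n
  proof -
    have "\<bar>real_of_int (e n) - real_of_int (e K)\<bar> < 1"
      using K[OF that] K[of K] unfolding dist_real_def by linarith
    then show ?thesis by linarith
  qed
  then have ev: "\<forall>\<^sub>F n in sequentially. e n = e K" unfolding eventually_sequentially by blast
  then have "(\<lambda>n. real_of_int (e n)) \<longlonglongrightarrow> of_int (e K)"
    by (intro tendsto_eventually) (erule eventually_mono, simp)
  then show ?thesis using that[OF LIMSEQ_unique[OF assms] ev] by blast
qed

text \<open>Differencing with lag \<open>l\<close> cancels the periodic limit and turns the linear
  drift into a constant; integrality does the rest.\<close>

lemma cycle_imp_pisot:
  fixes \<alpha> \<beta> :: real and n :: "nat \<Rightarrow> nat"
  assumes "\<alpha> > 1" and P: "minimal_int_poly P \<alpha>" and "l > 0"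
    and n: "strict_mono_on {1..} n" "\<And>k. k \<ge> 1 \<Longrightarrow> n k > 0"
    and cyc: "converges_to_cycle (\<lambda>k. real (n (k + 1)) - \<alpha> * real (n k) - \<beta> * ln (real (n k))) l"
      (is "converges_to_cycle ?x l")
  shows "pisot \<alpha>"
    and "\<exists>m :: int. \<beta> * ln \<alpha> / (\<alpha> - 1) = of_int m / (of_nat l * of_int (poly P 1))"
proof -
  \<comment> \<open>The shift by one avoids \<open>n 0\<close>, about which nothing is
    known.\<close>
  define a where "a k = real (n (Suc k))" for k
  have mono: "strict_mono (\<lambda>k. n (Suc k))"
    using n(1) by (auto simp: strict_mono_def strict_mono_on_def)
  have a1: "a k \<ge> 1" for k using n(2)[of "Suc k"] by (simp add: a_def)
  have atop: "filterlim a at_top sequentially"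
    unfolding a_def by (rule filterlim_compose[OF filterlim_real_sequentially filterlim_subseq[OF mono]])
  have "Bseq (\<lambda>k. ?x (Suc k))"
    using converges_to_cycle_Bseq[OF \<open>l > 0\<close> cyc] Bseq_Suc_iff[of ?x] by simp
  moreover have "a (Suc k) = \<alpha> * a k + \<beta> * ln (a k) + ?x (Suc k)" for k by (simp add: a_def)
  ultimately have ratio: "(\<lambda>k. a (Suc k) / a k) \<longlonglongrightarrow> \<alpha>"
    and "convergent (\<lambda>k. ln (a k) - real k * ln \<alpha>)"
    using perturbed_geometric_growth[OF \<open>\<alpha> > 1\<close> a1 atop, of "\<lambda>k. ?x (Suc k)" \<beta>] by blast+
  then have "convergent (\<lambda>k. (ln (a k) - real k * ln \<alpha>) - ln \<alpha>)"
    by (intro convergent_diff[OF _ convergent_const])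
  then have "convergent (\<lambda>k. ln (real (n (Suc k))) - real (Suc k) * ln \<alpha>)"
    by (simp add: a_def algebra_simps)
  then have "convergent (\<lambda>k. ln (real (n k)) - real k * ln \<alpha>)"
    by (subst (asm) convergent_Suc_iff)
  then have "convergent (\<lambda>k. \<beta> * (ln (real (n k)) - real k * ln \<alpha>))"
    by (intro convergent_mult convergent_const)
  then have "converges_to_cycle (\<lambda>k. ?x k + \<beta> * (ln (real (n k)) - real k * ln \<alpha>)) l"
    by (rule converges_to_cycle_add[OF cyc])
  moreover define y where "y k = real (n (Suc k)) - \<alpha> * real (n k) - \<beta> * ln \<alpha> * real k" for k
  have "(\<lambda>k. ?x k + \<beta> * (ln (real (n k)) - real k * ln \<alpha>)) = y"
    by (auto simp: y_def algebra_simps)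
  ultimately have "converges_to_cycle y l" by (simp only:)
  then have ydiff: "(\<lambda>k. y (k + l) - y k) \<longlonglongrightarrow> 0"
    by (rule converges_to_cycle_diff_tendsto_0[OF \<open>l > 0\<close>])

  define D where "D = Abs_fps (\<lambda>k. int (n (Suc k + l)) - int (n (Suc k)))"
  define L where "L = \<beta> * ln \<alpha> * real l"
  have "fps_nth (fps_lin \<alpha> * ifps D) (Suc k) = (y (Suc k + l) - y (Suc k)) + L" for k
    by (simp add: D_def y_def L_def algebra_simps)
  moreover have "(\<lambda>k. (y (Suc k + l) - y (Suc k)) + L) \<longlonglongrightarrow> 0 + L"
    by (intro tendsto_intros LIMSEQ_Suc[OF ydiff])
  ultimately have "(\<lambda>k. fps_nth (fps_lin \<alpha> * ifps D) (Suc k)) \<longlonglongrightarrow> L" by simp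
  then have linD: "fps_nth (fps_lin \<alpha> * ifps D) \<longlonglongrightarrow> L" by (simp only: filterlim_sequentially_Suc)

  have "poly (ipoly P) \<alpha> = 0" using P by (simp add: minimal_int_poly_def)
  then obtain Q where Q: "ipoly P = [:-\<alpha>, 1:] * Q"
    "fps_of_poly (reflect_poly (ipoly P)) = fps_lin \<alpha> * fps_of_poly (reflect_poly Q)"
    by (rule reflect_poly_linear_factor)
  \<comment> \<open>Turns the limit \<open>poly Q 1 * L\<close> into \<open>- l * poly P 1\<close>
    times the quotient \<theta>, whence the numerator \<open>-e\<close> below.\<close>
  have Q1: "poly Q 1 * (1 - \<alpha>) = of_int (poly P 1)"
    using poly_ipoly_of_int[of P 1, where 'a=real] unfolding Q(1) by (simp add: algebra_simps)
  define E where "E = fps_of_poly (reflect_poly P) * D"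
  have "ifps E = fps_of_poly (reflect_poly (ipoly P)) * (ifps D :: real fps)"
    by (simp add: E_def ifps_mult ifps_of_poly reflect_ipoly)
  then have "ifps E = fps_of_poly (reflect_poly Q) * (fps_lin \<alpha> * ifps D)"
    by (simp add: Q(2) mult_ac)
  then have "fps_nth (ifps E) \<longlonglongrightarrow> poly (reflect_poly Q) 1 * L"
    using fps_of_poly_mult_tendsto[OF linD] by metis
  moreover have "fps_nth (ifps E) = (\<lambda>k. real_of_int (fps_nth E k))"
    by (rule ext) simp
  ultimately have "(\<lambda>k. real_of_int (fps_nth E k)) \<longlonglongrightarrow> poly Q 1 * L"
    by (simp add: poly_reflect_poly_nz)
  then obtain e where e: "poly Q 1 * L = of_int e" "\<forall>\<^sub>F k in sequentially. fps_nth E k = e"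
    by (rule int_sequence_tendsto_eventually)
  have P1: "poly P 1 \<noteq> 0"
    using minimal_int_poly_int_root[OF P, of 1] \<open>\<alpha> > 1\<close> by auto
  have "\<beta> * ln \<alpha> / (\<alpha> - 1) * (real l * of_int (poly P 1)) = of_int (-e)"
    using \<open>\<alpha> > 1\<close> by (simp add: e(1)[symmetric] Q1[symmetric] L_def field_simps)
  then have "\<beta> * ln \<alpha> / (\<alpha> - 1) = of_int (-e) / (of_nat l * of_int (poly P 1))"
    using \<open>l > 0\<close> P1 by (metis mult_eq_0_iff nonzero_eq_divide_eq not_gr0 of_int_0_eq_iff of_nat_eq_0_iff)
  then show "\<exists>m :: int. \<beta> * ln \<alpha> / (\<alpha> - 1) = of_int m / (of_nat l * of_int (poly P 1))" ..

  \<comment> \<open>The factor \<open>1 - x\<close> annihilates the eventually constant tail of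
    \<open>E\<close>.\<close>
  define W where "W = fps_lin 1 * D"
  obtain K where K: "\<And>k. k \<ge> K \<Longrightarrow> fps_nth E k = e"
    using e(2) by (auto simp: eventually_sequentially)
  have PW: "fps_of_poly (reflect_poly P) * W = fps_lin 1 * E"
    by (simp add: W_def E_def mult_ac)
  have "fps_nth (fps_lin 1 * E) k = 0" if "k \<ge> Suc K" for k
  proof -
    define k' where "k' = k - 1"
    have "k = Suc k'" "k' \<ge> K" using that by (simp_all add: k'_def)
    then show ?thesis using K[of k] K[of k'] by simp
  qed
  then have "fps_lin 1 * E = fps_of_poly (truncate_fps (Suc K) (fps_lin 1 * E))"
    by (intro fps_ext) simp
  then have "fps_of_poly (reflect_poly P) * W = fps_of_poly (truncate_fps (Suc K) (fps_lin 1 * E))"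
    by (simp only: PW)
  \<comment> \<open>A polynomial \<open>W\<close> would make \<open>D\<close> eventually constant,
    whereas \<open>a (Suc k) - a k\<close> is unbounded because the ratio tends to \<alpha> >
    1.\<close>
  moreover have "W \<noteq> fps_of_poly t" for t
  proof
    assume "W = fps_of_poly t"
    then have "fps_nth W (Suc k) = 0" if "k \<ge> degree t" for k
      using that by (simp add: coeff_eq_0)
    then have *: "fps_nth D (Suc k) = fps_nth D k" if "k \<ge> degree t" for k
      using that by (simp add: W_def)
    have const: "fps_nth D k = fps_nth D (degree t)" if "k \<ge> degree t" for k
      using that by (induction k rule: dec_induct) (simp_all add: *)
    have "filterlim (\<lambda>k. (a (Suc k) / a k - 1) * a k) at_top sequentially"
      by (rule filterlim_tendsto_pos_mult_at_top[OF tendsto_diff[OF ratio tendsto_const] _ atop])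
        (use \<open>\<alpha> > 1\<close> in simp)
    then obtain k0 where k0: "\<And>k. k \<ge> k0 \<Longrightarrow> (a (Suc k) / a k - 1) * a k > real_of_int (fps_nth D (degree t))"
      by (auto simp: filterlim_at_top_dense eventually_sequentially)
    define k where "k = max k0 (degree t)"
    have k: "k \<ge> k0" "k \<ge> degree t" by (simp_all add: k_def)
    have "(a (Suc k) / a k - 1) * a k = a (Suc k) - a k"
      using a1[of k] by (simp add: field_simps)
    also have "\<dots> \<le> a (k + l) - a k"
      using \<open>l > 0\<close> strict_mono_less_eq[OF mono, of "Suc k" "k + l"] by (simp add: a_def)
    also have "\<dots> = real_of_int (fps_nth D k)" by (simp add: D_def a_def)
    finally show False using k0[OF k(1)] const[OF k(2)] by simp
  qed
  moreover have "ifps W = fps_lin 1 * (ifps D :: real fps)"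
    by (simp add: W_def ifps_mult fps_lin_def ifps_of_poly map_poly_pCons)
  then have W_eq: "fps_lin \<alpha> * ifps W = fps_lin 1 * (fps_lin \<alpha> * ifps D)"
    by (simp only: mult.left_commute)
  have "fps_nth (fps_lin 1 * (fps_lin \<alpha> * ifps D)) \<longlonglongrightarrow> 0"
    using fps_of_poly_mult_tendsto[OF linD, of "[:1, -1:]"] unfolding fps_lin_def[of 1] by simp
  then have "fps_nth (fps_lin \<alpha> * ifps W) \<longlonglongrightarrow> 0" by (simp only: W_eq)
  ultimately show "pisot \<alpha>" by (rule pisotI[OF P \<open>\<alpha> > 1\<close>])
qed

section \<open>Sequences for a Pisot number\<close>

text \<open>The finitely many zeros of \<open>q\<close> lie outside the closed unit disc, hence
  outside a larger disc on which the reciprocal is analytic.\<close>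

lemma fps_inverse_poly_conv_radius:
  fixes q :: "complex poly"
  assumes nz: "\<And>z. norm z \<le> 1 \<Longrightarrow> poly q z \<noteq> 0" and g: "fps_of_poly q * g = 1"
  shows "fps_conv_radius g > 1" and "norm z \<le> 1 \<Longrightarrow> eval_fps g z = inverse (poly q z)"
proof -
  define S where "S = {z. poly q z = 0}"
  have "q \<noteq> 0" using nz[of 0] by auto
  then have "finite S" by (simp add: S_def poly_roots_finite)
  \<comment> \<open>The value 2 covers a \<open>q\<close> without zeros.\<close>
  define r where "r = Min (insert 2 (norm ` S))"
  have "norm z > 1" if "z \<in> S" for z
    using that nz[of z] by (auto simp: S_def not_le[symmetric])
  then have r: "r > 1" using \<open>finite S\<close> by (simp add: r_def)
  have nz': "poly q z \<noteq> 0" if "norm z < r" for z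
    using that \<open>finite S\<close> by (auto simp: r_def S_def)
  have g_eq: "inverse (fps_of_poly q) = g" by (rule fps_inverse_unique[OF g])
  have *: "eval_fps (fps_of_poly q) z \<noteq> 0" if "ereal (norm z) < ereal r" for z
    using nz'[of z] that by simp
  have "min (ereal r) (fps_conv_radius (fps_of_poly q)) \<le> fps_conv_radius g"
    using fps_conv_radius_inverse[OF *, where r="ereal r"] by (simp only: g_eq)
  then have "ereal r \<le> fps_conv_radius g" by simp
  moreover have "1 < ereal r" using r by (simp add: one_ereal_def)
  ultimately show "fps_conv_radius g > 1" by (rule order.strict_trans2[rotated])
  assume "norm z \<le> 1"
  then have "ereal (norm z) < ereal r" using r by simp
  then show "eval_fps g z = inverse (poly q z)"
    using eval_fps_inverse[OF *, where r="ereal r" and z=z] by (simp add: g_eq)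
qed

lemma pisot_lead_coeff:
  assumes P: "minimal_int_poly P \<alpha>" and "pisot \<alpha>"
  shows "lead_coeff P = 1"
proof -
  obtain p where p: "poly (ipoly p) \<alpha> = 0" "lead_coeff p = 1"
    using assms(2) by (auto simp: pisot_def algebraic_int_altdef_ipoly)
  then obtain q where "p = P * q" using minimal_int_poly_dvd[OF P] by blast
  then have "lead_coeff P * lead_coeff q = 1" using p(2) by (simp add: lead_coeff_mult)
  then have "is_unit (lead_coeff P)" by (metis dvd_triv_left)
  then show ?thesis using P by (simp add: minimal_int_poly_def)
qed

text \<open>\<open>T\<close> is the reciprocal of the reversed \<open>P\<close>, integral because
  \<open>P\<close> is monic, and \<open>g\<close> is the reciprocal of the reversed cofactor
  \<open>Q\<close>. The last two claims evaluate it at 1 and at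
  \<open>inverse \<alpha>\<close>.\<close>

lemma pisot_impulse_response:
  assumes P: "minimal_int_poly P \<alpha>" and pis: "pisot \<alpha>"
  obtains T :: "int fps" and g :: "real fps" where "g = fps_lin \<alpha> * ifps T" 
    and "summable (\<lambda>i. \<bar>fps_nth g i\<bar>)" and "summable (\<lambda>i. real i * \<bar>fps_nth g i\<bar>)"
    and "(\<Sum>i. fps_nth g i) = (1 - \<alpha>) / of_int (poly P 1)"
    and "(\<Sum>i. fps_nth g i / \<alpha> ^ i) \<noteq> 0"
proof -
  have "\<alpha> > 1" using pis by (simp add: pisot_def)
  define c where "c = complex_of_real \<alpha>"
  define T where "T = fps_right_inverse (fps_of_poly (reflect_poly P)) 1"
  have T: "fps_of_poly (reflect_poly P) * T = 1"
    unfolding T_def using pisot_lead_coeff[OF P pis] by (intro fps_right_inverse) simp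
  define g where "g = fps_lin \<alpha> * ifps T"
  \<comment> \<open>The complex copy of \<open>g\<close>: the conjugates, and thus the zeros of
    \<open>Q\<close>, may be non-real.\<close>
  define h where "h = fps_lin c * ifps T"
  have h: "fps_nth h i = of_real (fps_nth g i)" for i
    by (cases i) (simp_all add: g_def h_def c_def)
  have Pc: "minimal_int_poly P c"
    using P by (simp add: minimal_int_poly_def c_def poly_ipoly_of_real)
  then have "poly (ipoly P) c = 0" by (simp add: minimal_int_poly_def)
  then obtain Q where Q: "ipoly P = [:-c, 1:] * Q"
    "fps_of_poly (reflect_poly (ipoly P)) = fps_lin c * fps_of_poly (reflect_poly Q)"
    by (rule reflect_poly_linear_factor)
  define R where "R = reflect_poly Q"
  have "ifps (fps_of_poly (reflect_poly P) * T) = fps_of_poly (reflect_poly (ipoly P)) * (ifps T :: complex fps)"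
    by (simp add: ifps_mult ifps_of_poly reflect_ipoly)
  then have Rh: "fps_of_poly R * h = 1"
    unfolding T by (simp add: h_def R_def Q(2) mult_ac)
  have Qroot: "norm z < 1" if "poly Q z = 0" for z
  proof -
    have "poly (ipoly P) z = 0" unfolding Q(1) using that by simp
    then have "galois_conjugate \<alpha> z" using P by (auto simp: galois_conjugate_def)
    \<comment> \<open>Simplicity of the root \<alpha> keeps it from being a zero of \<open>Q\<close>
      as well.\<close>
    moreover have "z \<noteq> c"
    proof
      assume "z = c"
      then have "[:-c, 1:] dvd Q" using that by (simp add: poly_eq_0_iff_dvd)
      then obtain S where "Q = [:-c, 1:] * S" by (elim dvdE)
      then have "ipoly P = [:-c, 1:] * [:-c, 1:] * S" using Q(1) by (simp only: mult.assoc)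
      then have "poly (pderiv (ipoly P)) c = 0"
        by (simp only: pderiv_mult) simp
      then show False using minimal_int_poly_separable[OF Pc] by blast
    qed
    ultimately show ?thesis using pis by (auto simp: pisot_def c_def)
  qed
  have "Q \<noteq> 0" using Qroot[of 1] by auto
  \<comment> \<open>Zeros of \<open>R\<close> are inverses of zeros of \<open>Q\<close>, and
    \<open>poly R 0\<close> is the leading coefficient of \<open>Q\<close>.\<close>
  have Rnz: "poly R z \<noteq> 0" if "norm z \<le> 1" for z
  proof (cases "z = 0")
    case False
    then show ?thesis using Qroot[of "inverse z"] that
      by (auto simp: R_def poly_reflect_poly_nz norm_inverse inverse_less_1_iff)
  qed (simp add: R_def \<open>Q \<noteq> 0\<close>)
  have conv: "fps_conv_radius h > 1" "\<And>z. norm z \<le> 1 \<Longrightarrow> eval_fps h z = inverse (poly R z)"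
    using fps_inverse_poly_conv_radius[OF Rnz Rh] by blast+
  have rad: "fps_conv_radius g > 1"
  proof -
    have "fps_conv_radius h = conv_radius (\<lambda>i. norm (fps_nth h i))" by (simp add: fps_conv_radius_def)
    also have "\<dots> = conv_radius (\<lambda>i. norm (fps_nth g i))" by (simp add: h del: conv_radius_norm)
    also have "\<dots> = fps_conv_radius g" by (simp only: conv_radius_norm fps_conv_radius_def)
    finally show ?thesis using conv(1) by simp
  qed
  have eval: "eval_fps h (of_real x) = of_real (\<Sum>i. fps_nth g i * x ^ i)" if "\<bar>x\<bar> \<le> 1" for x
  proof -
    have "ereal \<bar>x\<bar> \<le> 1" using that by (simp add: one_ereal_def)
    then have "ereal \<bar>x\<bar> < fps_conv_radius g" using rad by (rule le_less_trans)
    then have "summable (\<lambda>i. fps_nth g i * x ^ i)" by (intro summable_fps) simp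
    then show ?thesis by (simp add: eval_fps_def h suminf_of_real)
  qed
  show ?thesis
  proof (rule that[OF g_def])
    show "summable (\<lambda>i. \<bar>fps_nth g i\<bar>)"
      using norm_summable_fps[of 1 g] rad by (simp add: one_ereal_def)
    have "ereal (norm (1::real)) < fps_conv_radius (fps_deriv g)"
      using rad fps_conv_radius_deriv[of g] by (simp add: one_ereal_def order.strict_trans2)
    from norm_summable_fps[OF this] have "summable (\<lambda>i. real (Suc i) * \<bar>fps_nth g (Suc i)\<bar>)"
      by (simp add: abs_mult add.commute)
    then show "summable (\<lambda>i. real i * \<bar>fps_nth g i\<bar>)" by (subst (asm) summable_Suc_iff)
    have "poly R 1 = poly Q 1" by (simp add: R_def poly_reflect_poly_nz)
    moreover have "(1 - c) * poly Q 1 = of_int (poly P 1)"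
      using poly_ipoly_of_int[of P 1, where 'a=complex] unfolding Q(1) by (simp add: algebra_simps)
    ultimately have "(1 - c) / of_int (poly P 1) = inverse (poly R 1)"
      using \<open>\<alpha> > 1\<close> Rnz[of 1] by (auto simp: field_simps c_def)
    also have "\<dots> = of_real (\<Sum>i. fps_nth g i)" using conv(2)[of 1] eval[of 1] by simp
    finally have "complex_of_real ((1 - \<alpha>) / of_int (poly P 1)) = of_real (\<Sum>i. fps_nth g i)"
      by (simp add: c_def)
    then show "(\<Sum>i. fps_nth g i) = (1 - \<alpha>) / of_int (poly P 1)" by (simp only: of_real_eq_iff)
    have le: "\<bar>inverse \<alpha>\<bar> \<le> 1" using \<open>\<alpha> > 1\<close> by (simp add: inverse_le_1_iff)
    then have le': "norm (complex_of_real (inverse \<alpha>)) \<le> 1" by (simp only: norm_of_real)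
    have "complex_of_real (\<Sum>i. fps_nth g i * inverse \<alpha> ^ i) \<noteq> 0"
      unfolding eval[OF le, symmetric] conv(2)[OF le'] using Rnz[OF le'] by simp
    then show "(\<Sum>i. fps_nth g i / \<alpha> ^ i) \<noteq> 0"
      by (simp add: power_inverse divide_inverse)
  qed
qed

text \<open>The partial sums telescope; their convergence will yield a limit of
  \<open>f k / \<alpha> ^ k\<close>.\<close>

lemma fps_lin_divide_power:
  fixes F :: "'a::field fps"
  assumes "a \<noteq> 0"
  shows "fps_nth F k / a ^ k = (\<Sum>i\<le>k. fps_nth (fps_lin a * F) i / a ^ i)"
proof (induction k)
  case (Suc k)
  have "fps_nth F (Suc k) / a ^ Suc k = fps_nth F k / a ^ k + fps_nth (fps_lin a * F) (Suc k) / a ^ Suc k"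
    using assms by (simp add: field_simps del: mult.commute)
  then show ?case by (simp add: Suc del: fps_lin_mult_nth_Suc)
qed simp

text \<open>The floor sequence is a line of slope \<open>- m / l\<close> plus an
  \<open>l\<close>-periodic bounded part \<open>p\<close>. Convolution with \<open>g\<close> scales
  the slope by the sum of \<open>g\<close>, up to convergent corrections, and the periodic part
  converges along each residue class.\<close>

lemma convolution_with_floor_sequence:
  fixes g :: "real fps" and m :: int
  assumes "l > 0" and g: "summable (\<lambda>i. \<bar>fps_nth g i\<bar>)" and ig: "summable (\<lambda>i. real i * \<bar>fps_nth g i\<bar>)"
  shows "convergent (\<lambda>q. fps_nth (g * ifps (Abs_fps (\<lambda>k. (- m * int k) div int l))) (q * l + j)
           + of_int m / real l * (\<Sum>i. fps_nth g i) * real (q * l + j))"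
proof -
  define u where "u n = (- m * n) div int l" for n
  define p where "p n = real_of_int (u n) + of_int m / real l * of_int n" for n
  define S where "S = (\<Sum>i. fps_nth g i)"
  have periodic: "p (int q * int l + n) = p n" for q n
  proof -
    have "- m * (int q * int l + n) = - m * n + (- m * int q) * int l" by (simp add: algebra_simps)
    then have "u (int q * int l + n) = (- m * n + (- m * int q) * int l) div int l"
      by (simp only: u_def)
    also have "\<dots> = u n - m * int q"
      using \<open>l > 0\<close> by (subst div_mult_self1) (simp_all add: u_def)
    finally have eq: "u (int q * int l + n) = u n - m * int q" .
    show ?thesis using \<open>l > 0\<close> unfolding p_def eq by (simp add: field_simps)
  qed
  have bound: "\<bar>p n\<bar> \<le> 1" for n
  proof -
    have "u n = \<lfloor>- of_int m * of_int n / real l\<rfloor>"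
      using floor_divide_of_int_eq[of "- m * n" "int l", where 'a=real] by (simp add: u_def)
    then have "p n = \<lfloor>- of_int m * of_int n / real l\<rfloor> - (- of_int m * of_int n / real l)"
      by (simp add: p_def)
    then show ?thesis by linarith
  qed
  have gs: "summable (\<lambda>i. fps_nth g i)" using g by (rule summable_rabs_cancel)
  define A where "A k = (\<Sum>i<Suc k. real i * fps_nth g i)" for k
  \<comment> \<open>The error of replacing a partial sum of \<open>g\<close> by \<open>S\<close> in
    the linear term; it is dominated by a tail of the series of
    \<open>real i * \<bar>fps_nth g i\<bar>\<close>.\<close>
  define B where "B k = real k * (S - (\<Sum>i<Suc k. fps_nth g i))" for k
  have "summable (\<lambda>i. real i * fps_nth g i)"
    using ig by (intro summable_rabs_cancel[of "\<lambda>i. real i * fps_nth g i"]) (simp add: abs_mult)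
  then have "convergent (\<lambda>k. \<Sum>i<k. real i * fps_nth g i)" by (simp add: summable_iff_convergent)
  then have A: "convergent A" unfolding A_def by (subst convergent_Suc_iff)
  have "\<bar>B k\<bar> \<le> (\<Sum>i. real (i + Suc k) * \<bar>fps_nth g (i + Suc k)\<bar>)" for k
  proof -
    have s1: "summable (\<lambda>i. \<bar>fps_nth g (i + Suc k)\<bar>)" "summable (\<lambda>i. real (i + Suc k) * \<bar>fps_nth g (i + Suc k)\<bar>)"
      using summable_ignore_initial_segment[OF g, of "Suc k"] summable_ignore_initial_segment[OF ig, of "Suc k"] by auto
    have "B k = real k * (\<Sum>i. fps_nth g (i + Suc k))"
      by (simp only: B_def S_def suminf_minus_initial_segment[OF gs])
    then have "\<bar>B k\<bar> \<le> real k * (\<Sum>i. \<bar>fps_nth g (i + Suc k)\<bar>)"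
      using summable_rabs[OF s1(1)] by (simp add: abs_mult mult_left_mono)
    also have "\<dots> = (\<Sum>i. real k * \<bar>fps_nth g (i + Suc k)\<bar>)" by (rule suminf_mult[OF s1(1), symmetric])
    also have "\<dots> \<le> (\<Sum>i. real (i + Suc k) * \<bar>fps_nth g (i + Suc k)\<bar>)"
      by (intro suminf_le summable_mult s1 mult_right_mono) auto
    finally show ?thesis .
  qed
  moreover have "(\<lambda>k. \<Sum>i. real (i + Suc k) * \<bar>fps_nth g (i + Suc k)\<bar>) \<longlonglongrightarrow> 0"
  proof -
    have "(\<lambda>k. (\<Sum>i. real i * \<bar>fps_nth g i\<bar>) - (\<Sum>i<Suc k. real i * \<bar>fps_nth g i\<bar>)) \<longlonglongrightarrow> 0"
      using tendsto_diff[OF tendsto_const[of "\<Sum>i. real i * \<bar>fps_nth g i\<bar>"] LIMSEQ_Suc[OF summable_LIMSEQ[OF ig]]]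
      by simp
    then show ?thesis by (simp only: suminf_minus_initial_segment[OF ig])
  qed
  ultimately have "B \<longlonglongrightarrow> 0"
    by (intro Lim_null_comparison[of B]) auto
  then have B: "convergent B" by (auto simp: convergent_def)
  have sub: "strict_mono (\<lambda>q. q * l + j)" using \<open>l > 0\<close> by (auto simp: strict_mono_def)
  have "summable (\<lambda>i. fps_nth g i * p (int j - int i))"
    by (rule summable_comparison_test'[OF g, of 0])
      (use mult_left_mono[OF bound] in \<open>simp add: abs_mult\<close>)
  then have "convergent (\<lambda>k. \<Sum>i<k. fps_nth g i * p (int j - int i))" by (simp add: summable_iff_convergent)
  then have "convergent (\<lambda>k. \<Sum>i<Suc k. fps_nth g i * p (int j - int i))" by (subst convergent_Suc_iff)
  then have "convergent (\<lambda>q. \<Sum>i<Suc (q * l + j). fps_nth g i * p (int j - int i))"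
    using convergent_subseq_convergent[OF _ sub] by (force simp: o_def)
  moreover have "convergent (\<lambda>q. A (q * l + j))" "convergent (\<lambda>q. B (q * l + j))"
    using convergent_subseq_convergent[OF A sub] convergent_subseq_convergent[OF B sub] by (simp_all add: o_def)
  ultimately have "convergent (\<lambda>q. (\<Sum>i<Suc (q * l + j). fps_nth g i * p (int j - int i))
      + of_int m / real l * (A (q * l + j) + B (q * l + j)))"
    by (intro convergent_add convergent_mult convergent_const)
  moreover have "(\<Sum>i<Suc (q * l + j). fps_nth g i * p (int j - int i))
      + of_int m / real l * (A (q * l + j) + B (q * l + j))
      = fps_nth (g * ifps (Abs_fps (\<lambda>k. (- m * int k) div int l))) (q * l + j)
           + of_int m / real l * S * real (q * l + j)" for q
  proof -
    define k where "k = q * l + j"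
    have "fps_nth (g * ifps (Abs_fps (\<lambda>k. u (int k)))) k = (\<Sum>i<Suc k. fps_nth g i * real_of_int (u (int k - int i)))"
      by (simp add: fps_mult_nth atLeast0AtMost lessThan_Suc_atMost of_nat_diff)
    also have "\<dots> = (\<Sum>i<Suc k. fps_nth g i * p (int j - int i) + of_int m / real l * (real i * fps_nth g i)
        - of_int m / real l * real k * fps_nth g i)"
    proof (rule sum.cong[OF refl])
      fix i assume "i \<in> {..<Suc k}"
      \<comment> \<open>Now \<open>q\<close> affects only the number of summands;
        \<open>j - i\<close> may be negative, which is why \<open>u\<close> and \<open>p\<close>
        live on the integers.\<close>
      have "p (int k - int i) = p (int j - int i)"
        using periodic[of q "int j - int i"] by (simp add: k_def algebra_simps)
      then have eq: "real_of_int (u (int k - int i)) = p (int j - int i) - of_int m / real l * (real k - real i)"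
        by (simp add: p_def)
      have "x * (y - c * (a - b)) = x * y + c * (b * x) - c * a * x" for x y c a b :: real
        by (simp add: algebra_simps)
      then show "fps_nth g i * real_of_int (u (int k - int i)) = fps_nth g i * p (int j - int i) + of_int m / real l * (real i * fps_nth g i)
        - of_int m / real l * real k * fps_nth g i"
        unfolding eq .
    qed
    also have "\<dots> = (\<Sum>i<Suc k. fps_nth g i * p (int j - int i)) + of_int m / real l * A k
        - of_int m / real l * real k * (\<Sum>i<Suc k. fps_nth g i)"
      unfolding A_def by (simp only: sum.distrib sum_subtractf sum_distrib_left)
    also have "\<dots> = (\<Sum>i<Suc k. fps_nth g i * p (int j - int i)) + of_int m / real l * (A k + B k)
        - of_int m / real l * S * real k"
      unfolding B_def by (simp only: ring_distribs mult_ac)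
    finally show ?thesis by (simp add: u_def k_def)
  qed
  ultimately show ?thesis by (simp add: S_def)
qed

text \<open>The sequence is a tail of the coefficients of \<open>F = T * (U + fps_const N)\<close>:
  \<open>U\<close> produces the required drift, \<open>N\<close> makes the growth positive.\<close>

lemma pisot_imp_cycle:
  fixes \<alpha> \<beta> :: real
  assumes P: "minimal_int_poly P \<alpha>" and "l > 0" and pis: "pisot \<alpha>"
    and theta: "\<beta> * ln \<alpha> / (\<alpha> - 1) = of_int m / (of_nat l * of_int (poly P 1))"
  shows "\<exists>n :: nat \<Rightarrow> nat. strict_mono n \<and> (\<forall>k. n k > 0) \<and>
    converges_to_cycle (\<lambda>k. real (n (k + 1)) - \<alpha> * real (n k) - \<beta> * ln (real (n k))) l"
proof -
  have "\<alpha> > 1" using pis by (simp add: pisot_def)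
  obtain T g where g: "g = fps_lin \<alpha> * ifps T" "summable (\<lambda>i. \<bar>fps_nth g i\<bar>)"
      "summable (\<lambda>i. real i * \<bar>fps_nth g i\<bar>)" "(\<Sum>i. fps_nth g i) = (1 - \<alpha>) / of_int (poly P 1)"
      "(\<Sum>i. fps_nth g i / \<alpha> ^ i) \<noteq> 0"
    by (rule pisot_impulse_response[OF P pis])
  define U where "U = Abs_fps (\<lambda>k. (- m * int k) div int l)"
  define G where "G = (\<Sum>i. fps_nth g i / \<alpha> ^ i)"
  define e where "e k = fps_nth (g * ifps U) k - \<beta> * ln \<alpha> * real k" for k
  \<comment> \<open>This is where the arithmetic condition enters: the drift of
    \<open>g * ifps U\<close> is exactly \<open>\<beta> * ln \<alpha>\<close> per step.\<close>
  have slope: "of_int m / real l * (\<Sum>i. fps_nth g i) = - (\<beta> * ln \<alpha>)"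
  proof -
    have "\<beta> * ln \<alpha> = (\<alpha> - 1) * (of_int m / (of_nat l * of_int (poly P 1)))"
      using \<open>\<alpha> > 1\<close> by (simp flip: theta)
    moreover define d where "d = \<alpha> - 1"
    then have "1 - \<alpha> = - d" by simp
    ultimately show ?thesis by (simp only: g(4) d_def[symmetric]) simp
  qed
  have e: "convergent (\<lambda>q. e (q * l + j))" for j
    using convolution_with_floor_sequence[OF \<open>l > 0\<close> g(2,3), of m j]
    unfolding slope e_def U_def by simp
  then have "Bseq e"
    by (intro converges_to_cycle_Bseq[OF \<open>l > 0\<close>]) (simp add: converges_to_cycle_def)
  then obtain M where M: "M > 0" "\<And>k. \<bar>e k\<bar> \<le> M" by (auto elim: BseqE)

  have sum_gU: "summable (\<lambda>i. fps_nth (g * ifps U) i / \<alpha> ^ i)"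
  proof (rule summable_comparison_test')
    have "norm (inverse \<alpha>) < 1" using \<open>\<alpha> > 1\<close> by (simp add: inverse_less_1_iff)
    then show "summable (\<lambda>i. (M + \<bar>\<beta> * ln \<alpha>\<bar>) * (of_nat (Suc i) * inverse \<alpha> ^ i))"
      by (intro summable_mult sums_summable[OF geometric_deriv_sums])
    fix i :: nat
    have "\<bar>fps_nth (g * ifps U) i\<bar> \<le> \<bar>e i\<bar> + \<bar>\<beta> * ln \<alpha> * real i\<bar>" by (simp add: e_def)
    also have "\<dots> \<le> M + \<bar>\<beta> * ln \<alpha>\<bar> * real i" using M(2)[of i] by (simp add: abs_mult)
    also have "\<dots> \<le> (M + \<bar>\<beta> * ln \<alpha>\<bar>) * real (Suc i)"
      using M(1) by (simp add: algebra_simps)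
    finally have "\<bar>fps_nth (g * ifps U) i\<bar> / \<alpha> ^ i \<le> (M + \<bar>\<beta> * ln \<alpha>\<bar>) * real (Suc i) / \<alpha> ^ i"
      using \<open>\<alpha> > 1\<close> by (intro divide_right_mono) auto
    then show "norm (fps_nth (g * ifps U) i / \<alpha> ^ i) \<le> (M + \<bar>\<beta> * ln \<alpha>\<bar>) * (of_nat (Suc i) * inverse \<alpha> ^ i)"
      using \<open>\<alpha> > 1\<close> by (simp only: real_norm_def abs_divide) (simp add: divide_inverse power_inverse mult.assoc)
  qed
  have sum_g: "summable (\<lambda>i. fps_nth g i / \<alpha> ^ i)"
  proof (rule summable_comparison_test'[OF g(2)])
    fix i :: nat
    have "\<bar>fps_nth g i\<bar> / \<alpha> ^ i \<le> \<bar>fps_nth g i\<bar> / 1"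
      using \<open>\<alpha> > 1\<close> by (intro divide_left_mono) (auto simp: one_le_power)
    then show "norm (fps_nth g i / \<alpha> ^ i) \<le> \<bar>fps_nth g i\<bar>" using \<open>\<alpha> > 1\<close> by simp
  qed

  \<comment> \<open>Possible since \<open>G\<close> is nonzero; the sum is the limit of
    \<open>f k / \<alpha> ^ k\<close>.\<close>
  obtain N :: int where N: "(\<Sum>i. fps_nth (g * ifps U) i / \<alpha> ^ i) + of_int N * G > 0" (is "?C0 + _ > 0")
  proof (cases "G > 0")
    case True
    obtain N :: int where "- ?C0 / G < of_int N" using ex_less_of_int by blast
    then show ?thesis using True by (intro that[of N]) (simp add: field_simps)
  next
    case False
    then have "G < 0" using g(5) by (simp add: G_def)
    obtain N :: int where "of_int N < - ?C0 / G" using ex_of_int_less by blast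
    then show ?thesis using \<open>G < 0\<close> by (intro that[of N]) (simp add: field_simps)
  qed
  define C where "C = ?C0 + of_int N * G"
  define F where "F = T * (U + fps_const N)"
  define f where "f k = real_of_int (fps_nth F k)" for k
  have "ifps (fps_const N) = (fps_const (of_int N) :: real fps)" by (rule fps_ext) simp
  then have linF: "fps_lin \<alpha> * ifps F = g * ifps U + fps_const (of_int N) * g"
    by (simp add: F_def g(1) ifps_mult ifps_add algebra_simps)
  have "f k / \<alpha> ^ k = (\<Sum>i\<le>k. fps_nth (g * ifps U) i / \<alpha> ^ i) + of_int N * (\<Sum>i\<le>k. fps_nth g i / \<alpha> ^ i)" for k
    using fps_lin_divide_power[of \<alpha> "ifps F" k] \<open>\<alpha> > 1\<close>
    by (simp add: f_def linF add_divide_distrib sum.distrib sum_distrib_left del: fps_lin_mult_nth_Suc)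
  moreover have "(\<lambda>k. (\<Sum>i\<le>k. fps_nth (g * ifps U) i / \<alpha> ^ i) + of_int N * (\<Sum>i\<le>k. fps_nth g i / \<alpha> ^ i)) \<longlonglongrightarrow> C"
    unfolding C_def G_def by (intro tendsto_intros summable_LIMSEQ' sum_gU sum_g)
  ultimately have fC: "(\<lambda>k. f k / \<alpha> ^ k) \<longlonglongrightarrow> C" by simp
  have "C > 0" using N by (simp add: C_def)

  \<comment> \<open>The normalised increments of \<open>f\<close> have a positive limit, so
    \<open>f\<close> is eventually strictly increasing.\<close>
  have "(\<lambda>k. \<alpha> * (f (Suc k) / \<alpha> ^ Suc k) - f k / \<alpha> ^ k) \<longlonglongrightarrow> \<alpha> * C - C"
    by (intro tendsto_intros fC LIMSEQ_Suc[OF fC])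
  moreover have "\<alpha> * C - C > 0" using \<open>C > 0\<close> \<open>\<alpha> > 1\<close> by (simp add: algebra_simps)
  ultimately have "\<forall>\<^sub>F k in sequentially. \<alpha> * (f (Suc k) / \<alpha> ^ Suc k) - f k / \<alpha> ^ k > 0"
    by (rule order_tendstoD)
  moreover have "\<alpha> * (f (Suc k) / \<alpha> ^ Suc k) - f k / \<alpha> ^ k = (f (Suc k) - f k) / \<alpha> ^ k" for k
    using \<open>\<alpha> > 1\<close> by (simp add: field_simps)
  ultimately have "\<forall>\<^sub>F k in sequentially. (f (Suc k) - f k) / \<alpha> ^ k > 0" by (simp only:)
  then have "\<forall>\<^sub>F k in sequentially. f k < f (Suc k)"
    by (rule eventually_mono) (use \<open>\<alpha> > 1\<close> in \<open>auto simp: zero_less_divide_iff\<close>)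
  moreover have "\<forall>\<^sub>F k in sequentially. f k / \<alpha> ^ k > 0"
    using fC \<open>C > 0\<close> by (rule order_tendstoD)
  then have fpos: "\<forall>\<^sub>F k in sequentially. f k > 0"
    using \<open>\<alpha> > 1\<close> by (simp add: zero_less_divide_iff)
  ultimately obtain K where K: "\<And>k. k \<ge> K \<Longrightarrow> f k > 0" "\<And>k. k \<ge> K \<Longrightarrow> f k < f (Suc k)"
    unfolding eventually_sequentially by (metis linorder_le_cases order_trans)

  have "(\<lambda>k. ln (f k / \<alpha> ^ k)) \<longlonglongrightarrow> ln C" using fC \<open>C > 0\<close> by (intro tendsto_ln) auto
  moreover have "\<forall>\<^sub>F k in sequentially. ln (f k / \<alpha> ^ k) = ln (f k) - real k * ln \<alpha>"
    using fpos by eventually_elim (use \<open>\<alpha> > 1\<close> in \<open>simp add: ln_div ln_realpow\<close>)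
  ultimately have lnf: "(\<lambda>k. ln (f k) - real k * ln \<alpha>) \<longlonglongrightarrow> ln C"
    by (rule Lim_transform_eventually)
  define X where "X k = f (Suc k) - \<alpha> * f k - \<beta> * ln (f k)" for k
  have X_eq: "X k = e (Suc k) + \<beta> * ln \<alpha> + of_int N * fps_nth g (Suc k) - \<beta> * (ln (f k) - real k * ln \<alpha>)" for k
  proof -
    have "f (Suc k) - \<alpha> * f k = fps_nth (g * ifps U) (Suc k) + of_int N * fps_nth g (Suc k)"
      using arg_cong[OF linF, of "\<lambda>F. fps_nth F (Suc k)"] by (simp add: f_def)
    then show ?thesis by (simp add: X_def e_def algebra_simps)
  qed
  have "fps_nth g \<longlonglongrightarrow> 0"
    using g(2) by (rule summable_LIMSEQ_zero[OF summable_rabs_cancel])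
  then have "(\<lambda>k. of_int N * fps_nth g (Suc k) - \<beta> * (ln (f k) - real k * ln \<alpha>)) \<longlonglongrightarrow> of_int N * 0 - \<beta> * ln C"
    by (intro tendsto_intros lnf LIMSEQ_Suc)
  then have "convergent (\<lambda>k. of_int N * fps_nth g (Suc k) - \<beta> * (ln (f k) - real k * ln \<alpha>))"
    by (rule convergentI)
  moreover have "converges_to_cycle (\<lambda>k. e (Suc k) + \<beta> * ln \<alpha>) l"
    unfolding converges_to_cycle_def
  proof (intro allI impI convergent_add convergent_const)
    show "convergent (\<lambda>k. e (Suc (k * l + j)))" for j using e[of "Suc j"] by simp
  qed
  ultimately have "converges_to_cycle X l"
    using converges_to_cycle_add unfolding X_eq add_diff_eq[symmetric] by blast

  \<comment> \<open>Shifting by a multiple of \<open>l\<close> preserves the residue classes, and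
    \<open>K * l \<ge> K\<close> reaches the range where \<open>f\<close> is positive and
    increasing.\<close>
  define n where "n k = nat (fps_nth F (k + K * l))" for k
  have large: "k + K * l \<ge> K" for k using \<open>l > 0\<close> by (simp add: trans_le_add2)
  have n_f: "real (n k) = f (k + K * l)" for k
    using K(1)[OF large, of k] by (simp add: n_def f_def)
  show ?thesis
  proof (intro exI[of _ n] conjI allI)
    have "real (n k) < real (n (Suc k))" for k
      using K(2)[OF large, of k] by (simp add: n_f)
    then show "strict_mono n" by (simp add: strict_mono_Suc_iff)
    show "n k > 0" for k
      using K(1)[OF large, of k] n_f[of k] by (metis of_nat_0_less_iff)
    have "convergent (\<lambda>q. X ((q + K) * l + j))" if "j < l" for j
      using \<open>converges_to_cycle X l\<close> that unfolding converges_to_cycle_def convergent_def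
      by (metis LIMSEQ_ignore_initial_segment[of "\<lambda>q. X (q * l + j)"])
    then show "converges_to_cycle (\<lambda>k. real (n (k + 1)) - \<alpha> * real (n k) - \<beta> * ln (real (n k))) l"
      by (simp add: converges_to_cycle_def n_f X_def algebra_simps)
  qed
qed

theorem theorem1p8:
  fixes \<alpha> \<beta> :: real and P :: "int poly" and l :: nat
  assumes "\<alpha> > 1"
    and "algebraic \<alpha>"
    and "minimal_int_poly P \<alpha>"
    and "l > 0"
  shows "(\<exists>n :: nat \<Rightarrow> nat. strict_mono_on {1..} n \<and> (\<forall>k\<ge>1. n k > 0) \<and>
            converges_to_cycle
              (\<lambda>k. real (n (k + 1)) - \<alpha> * real (n k) - \<beta> * ln (real (n k))) l)
         \<longleftrightarrow>
         pisot \<alpha> \<and>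
         (\<exists>m :: int. \<beta> * ln \<alpha> / (\<alpha> - 1) = of_int m / (of_nat l * of_int (poly P 1)))"
    (is "?lhs \<longleftrightarrow> ?rhs")
proof
  assume ?lhs
  then show ?rhs using cycle_imp_pisot[OF assms(1,3,4)] by blast
next
  assume ?rhs
  then obtain m where "pisot \<alpha>" and "\<beta> * ln \<alpha> / (\<alpha> - 1) = of_int m / (of_nat l * of_int (poly P 1))"
    by blast
  then obtain n :: "nat \<Rightarrow> nat" where "strict_mono n" "\<forall>k. n k > 0"
    "converges_to_cycle (\<lambda>k. real (n (k + 1)) - \<alpha> * real (n k) - \<beta> * ln (real (n k))) l"
    using pisot_imp_cycle[OF assms(3,4)] by blast
  then show ?lhs by (intro exI[of _ n]) (auto simp: strict_mono_on_def strict_mono_def)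
qed

end
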